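(* Let $A\in\mathbb{Q}_s^{m\times n}$, let $\lambda\in\mathbb{R}\setminus\{0\}$, and let $U\in\mathbb{Q}_s^{m\times m}$, $V\in\mathbb{Q}_s^{n\times n}$ satisfy $U^HU=UU^H=I$ and $V^HV=VV^H=I$. Then $$(A^\dagger)^\dagger=A,\qquad (A^H)^\dagger=(A^\dagger)^H,\qquad (\lambda A)^\dagger=\lambda^{-1}A^\dagger,\qquad (UAV)^\dagger=V^HA^\dagger U^H .$$ Moreover, $AA^\dagger$ and $A^\dagger A$ are $H$-Hermitian idempotents, i.e. each of them is a matrix $P$ with $P^H=P$ and $P^2=P$.
   Context: $\mathbb{Q}_s$ is the real algebra of split quaternions $q=q_1+q_2\mathbf{i}+q_3\mathbf{j}+q_4\mathbf{k}$ ($q_\ell\in\mathbb{R}$) with $\mathbf{i}^2=-1$, $\mathbf{j}^2=\mathbf{k}^2=1$, $\mathbf{i}\mathbf{j}=\mathbf{k}=-\mathbf{j}\mathbf{i}$, $\mathbf{j}\mathbf{k}=-\mathbf{i}=-\mathbf{k}\mathbf{j}$, $\mathbf{k}\mathbf{i}=\mathbf{j}=-\mathbf{i}\mathbf{k}$. A matrix $A\in\mathbb{Q}_s^{m\times n}$ is written $A=A_1+A_2\mathbf{i}+A_3\mathbf{j}+A_4\mathbf{k}$ with $A_\ell\in\mathbb{R}^{m\times n}$. Its real representation is $$A^\sigma=\begin{bmatrix} A_1+A_3 & -A_2+A_4 \\ A_2+A_4 & A_1-A_3 \end{bmatrix}\in\mathbb{R}^{2m\times 2n};$$ the map $\sigma: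 A\mapsto A^\sigma$ is a bijection $\mathbb{Q}_s^{m\times n}\to\mathbb{R}^{2m\times 2n}$ with inverse $\sigma^{-1}$. The $i$-conjugate transpose is $A^H:=A_1^T-A_2^T\mathbf{i}+A_3^T\mathbf{j}+A_4^T\mathbf{k}$. For a real matrix $M$, $M^\dagger$ is the usual real Moore--Penrose inverse; for $A\in\mathbb{Q}_s^{m\times n}$, $A^\dagger:=\sigma^{-1}((A^\sigma)^\dagger)\in\mathbb{Q}_s^{n\times m}$. *)

theory Defs
  imports "HOL-Analysis.Analysis"
begin

(* SQuat q1 q2 q3 q4 stands for q1 + q2 i + q3 j + q4 k. *)
codatatype squat = SQuat (sq1: real) (sq2: real) (sq3: real) (sq4: real)

lemma squat_eq_iff: "x = y \<longleftrightarrow> sq1 x = sq1 y \<and> sq2 x = sq2 y \<and> sq3 x = sq3 y \<and> sq4 x = sq4 y"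
  by (auto intro: squat.expand)

(* The product is the bilinear extension of i^2 = -1, j^2 = k^2 = 1, ij = k = -ji,
   jk = -i = -kj, ki = j = -ik; see squat_units below. *)
instantiation squat :: real_algebra_1
begin

primcorec zero_squat where
  "sq1 0 = 0" | "sq2 0 = 0" | "sq3 0 = 0" | "sq4 0 = 0"

primcorec one_squat where
  "sq1 1 = 1" | "sq2 1 = 0" | "sq3 1 = 0" | "sq4 1 = 0"

primcorec plus_squat where
  "sq1 (x + y) = sq1 x + sq1 y"
| "sq2 (x + y) = sq2 x + sq2 y"
| "sq3 (x + y) = sq3 x + sq3 y"
| "sq4 (x + y) = sq4 x + sq4 y"

primcorec uminus_squat where
  "sq1 (- x) = - sq1 x"
| "sq2 (- x) = - sq2 x"
| "sq3 (- x) = - sq3 x"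
| "sq4 (- x) = - sq4 x"

primcorec minus_squat where
  "sq1 (x - y) = sq1 x - sq1 y"
| "sq2 (x - y) = sq2 x - sq2 y"
| "sq3 (x - y) = sq3 x - sq3 y"
| "sq4 (x - y) = sq4 x - sq4 y"

primcorec scaleR_squat where
  "sq1 (r *\<^sub>R x) = r * sq1 x"
| "sq2 (r *\<^sub>R x) = r * sq2 x"
| "sq3 (r *\<^sub>R x) = r * sq3 x"
| "sq4 (r *\<^sub>R x) = r * sq4 x"

primcorec times_squat where
  "sq1 (x * y) = sq1 x * sq1 y - sq2 x * sq2 y + sq3 x * sq3 y + sq4 x * sq4 y"
| "sq2 (x * y) = sq1 x * sq2 y + sq2 x * sq1 y - sq3 x * sq4 y + sq4 x * sq3 y"
| "sq3 (x * y) = sq1 x * sq3 y - sq2 x * sq4 y + sq3 x * sq1 y + sq4 x * sq2 y"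
| "sq4 (x * y) = sq1 x * sq4 y + sq2 x * sq3 y - sq3 x * sq2 y + sq4 x * sq1 y"

instance
  by standard (simp_all add: squat_eq_iff algebra_simps)

end

definition squat_i :: squat where "squat_i = SQuat 0 1 0 0"
definition squat_j :: squat where "squat_j = SQuat 0 0 1 0"
definition squat_k :: squat where "squat_k = SQuat 0 0 0 1"

lemma squat_units:
  "squat_i * squat_i = - 1" "squat_j * squat_j = 1" "squat_k * squat_k = 1"
  "squat_i * squat_j = squat_k" "squat_j * squat_i = - squat_k"
  "squat_j * squat_k = - squat_i" "squat_k * squat_j = squat_i"
  "squat_k * squat_i = squat_j" "squat_i * squat_k = - squat_j"
  by (simp_all add: squat_eq_iff squat_i_def squat_j_def squat_k_def)

lemma SQuat_expand:
  "SQuat a b c d = a *\<^sub>R 1 + b *\<^sub>R squat_i + c *\<^sub>R squat_j + d *\<^sub>R squat_k"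
  by (simp add: squat_eq_iff squat_i_def squat_j_def squat_k_def)

(* A 2m x 2n block matrix is indexed by the sum types 'm + 'm and 'n + 'n:
   Inl is the first block, Inr the second one. *)
definition real_rep :: "squat^'n^'m \<Rightarrow> real^('n::finite + 'n)^('m::finite + 'm)" where
  "real_rep A = (\<chi> r c. case r of
       Inl i \<Rightarrow> (case c of
           Inl j \<Rightarrow> sq1 (A $ i $ j) + sq3 (A $ i $ j)
         | Inr j \<Rightarrow> - sq2 (A $ i $ j) + sq4 (A $ i $ j))
     | Inr i \<Rightarrow> (case c of
           Inl j \<Rightarrow> sq2 (A $ i $ j) + sq4 (A $ i $ j)
         | Inr j \<Rightarrow> sq1 (A $ i $ j) - sq3 (A $ i $ j)))"

lemma bij_real_rep: "bij (real_rep :: squat^'n::finite^'m::finite \<Rightarrow> _)"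
proof (rule bijI)
  show "inj (real_rep :: squat^'n^'m \<Rightarrow> _)"
  proof (rule injI)
    fix A B :: "squat^'n^'m"
    assume eq: "real_rep A = real_rep B"
    have "A $ i $ j = B $ i $ j" for i j
    proof -
      have *: "real_rep A $ r $ c = real_rep B $ r $ c" for r c
        by (simp add: eq)
      show ?thesis
        using *[of "Inl i" "Inl j"] *[of "Inl i" "Inr j"]
          *[of "Inr i" "Inl j"] *[of "Inr i" "Inr j"]
        by (simp add: real_rep_def squat_eq_iff)
    qed
    then show "A = B" by (simp add: vec_eq_iff)
  qed
  show "surj (real_rep :: squat^'n^'m \<Rightarrow> _)"
  proof (rule surjI)
    fix M :: "real^('n + 'n)^('m + 'm)"
    show "real_rep (\<chi> i j. SQuat
        ((M $ Inl i $ Inl j + M $ Inr i $ Inr j) / 2)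
        ((M $ Inr i $ Inl j - M $ Inl i $ Inr j) / 2)
        ((M $ Inl i $ Inl j - M $ Inr i $ Inr j) / 2)
        ((M $ Inr i $ Inl j + M $ Inl i $ Inr j) / 2)) = M"
      by (simp add: real_rep_def vec_eq_iff field_simps split: sum.split)
  qed
qed

definition i_conj_transpose :: "squat^'n^'m \<Rightarrow> squat^'m^'n"  ("(_\<^sup>H)" [1000] 999) where
  "A\<^sup>H = (\<chi> i j. SQuat (sq1 (A $ j $ i)) (- sq2 (A $ j $ i)) (sq3 (A $ j $ i)) (sq4 (A $ j $ i)))"

definition is_mp_inverse :: "real^'n^'m \<Rightarrow> real^'m^'n \<Rightarrow> bool" where
  "is_mp_inverse M X \<longleftrightarrow>
     M ** X ** M = M \<and> X ** M ** X = X \<and>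
     transpose (M ** X) = M ** X \<and> transpose (X ** M) = X ** M"

(* The matrix satisfying the four Penrose equations always exists and is unique. *)
definition real_mp_inverse :: "real^'n^'m \<Rightarrow> real^'m^'n" where
  "real_mp_inverse M = (THE X. is_mp_inverse M X)"

definition mp_inverse :: "squat^'n^'m \<Rightarrow> squat^'m^'n"  ("(_\<^sup>\<dagger>)" [1000] 999) where
  "A\<^sup>\<dagger> = inv real_rep (real_mp_inverse (real_rep A))"

end

theory Submission imports Defs begin

text \<open>
  The real representation is an injective algebra homomorphism that turns the
  \<open>i\<close>-conjugate transpose into the transpose. Hence \<open>A\<^sup>\<dagger>\<close> is the
  unique solution over the split quaternions of the four Penrose equations with \<open>\<^sup>H\<close> in
  place of the transpose, and each identity amounts to checking these equations for its
  right-hand side.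

  For a real matrix \<open>M\<close>, existence comes from the solvable normal equations: orthogonal
  projection onto the range gives \<open>Y\<close> with \<open>M\<^sup>T M Y = M\<^sup>T\<close>, and the same for the
  transpose gives \<open>W\<close> with \<open>W M M\<^sup>T = M\<^sup>T\<close>; then \<open>W M Y\<close> is the Moore--Penrose inverse.
\<close>

section \<open>Moore--Penrose inverses of real matrices\<close>

lemma normal_equation_solvable:
  fixes M :: "real^'n^'m" and b :: "real^'m"
  shows "\<exists>y. transpose M *v (M *v y) = transpose M *v b"
proof -
  have sub: "subspace (range ((*v) M))"
    by (simp add: linear_subspace_image)
  obtain p z where p: "p \<in> span (range ((*v) M))"
    and z: "\<And>w. w \<in> span (range ((*v) M)) \<Longrightarrow> orthogonal z w" and b: "b = p + z"
    using orthogonal_subspace_decomp_exists by metis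
  obtain y where y: "p = M *v y"
    using p sub by (auto simp: span_eq_iff[THEN iffD2])
  have "(transpose M *v z) \<bullet> v = 0" for v
    using z[of "M *v v"] by (simp add: span_base orthogonal_def dot_lmul_matrix)
  then have "transpose M *v z = 0"
    using inner_eq_zero_iff by blast
  then show ?thesis
    using b y by (auto simp: matrix_vector_right_distrib)
qed

lemma normal_equation_matrix_solvable:
  fixes M :: "real^'n^'m"
  shows "\<exists>Y. transpose M ** (M ** Y) = transpose M"
proof -
  obtain y where y: "\<And>b. transpose M *v (M *v y b) = transpose M *v b"
    using normal_equation_solvable by metis
  \<comment> \<open>The columns of \<open>Y\<close> solve the normal equations for the standard
    basis vectors.\<close>
  define Y :: "real^'m^'n" where "Y = (\<chi> i j. y (axis j 1) $ i)"
  have "Y *v axis j 1 = y (axis j 1)" for j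
    by (simp add: Y_def matrix_vector_mult_basis column_def vec_eq_iff)
  then have "column j (transpose M ** (M ** Y)) = column j (transpose M)" for j
    using y by (simp flip: matrix_vector_mult_basis matrix_vector_mul_assoc)
  then show ?thesis
    by (auto simp: column_def vec_eq_iff intro!: exI[of _ Y])
qed

text \<open>For \<open>P = M ** Y\<close> the normal equations give
  \<open>transpose P ** P = transpose P\<close>. The left side is symmetric, hence so is
  \<open>P\<close>, and transposing the normal equations then yields
  \<open>P ** M = M\<close>.\<close>

lemma least_squares_inverse_exists:
  fixes M :: "real^'n^'m"
  shows "\<exists>Y. M ** Y ** M = M \<and> transpose (M ** Y) = M ** Y"
proof -
  obtain Y where Y: "transpose M ** (M ** Y) = transpose M"
    using normal_equation_matrix_solvable by blast
  have "transpose (M ** Y) ** (M ** Y) = transpose (M ** Y)"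
    using Y by (simp add: matrix_transpose_mul flip: matrix_mul_assoc)
  then have sym: "transpose (M ** Y) = M ** Y"
    by (metis matrix_transpose_mul transpose_transpose)
  moreover have "M ** Y ** M = M"
    using Y sym by (metis matrix_transpose_mul transpose_transpose)
  ultimately show ?thesis by blast
qed

lemma is_mp_inverse_exists:
  fixes M :: "real^'n^'m"
  shows "\<exists>X. is_mp_inverse M X"
proof -
  obtain Y where Y: "M ** Y ** M = M" "transpose (M ** Y) = M ** Y"
    using least_squares_inverse_exists by blast
  obtain Z where Z: "transpose M ** Z ** transpose M = transpose M"
      "transpose (transpose M ** Z) = transpose M ** Z"
    using least_squares_inverse_exists by blast
  define W where "W = transpose Z"
  have W: "M ** W ** M = M" "transpose (W ** M) = W ** M"
    using arg_cong[OF Z(1), of transpose] Z(2)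
    by (simp_all add: W_def matrix_transpose_mul matrix_mul_assoc)
  have MX: "M ** (W ** M ** Y) = M ** Y"
    using W by (simp add: matrix_mul_assoc)
  have XM: "W ** M ** Y ** M = W ** M"
    using Y by (simp flip: matrix_mul_assoc)
  \<comment> \<open>For \<open>X = W ** M ** Y\<close> this reduces \<open>X ** M ** X\<close> to
    \<open>X\<close>, since \<open>M ** W ** M = M\<close>.\<close>
  have "W ** M ** Y ** M ** (W ** M ** Y) = W ** (M ** W ** M) ** Y"
    unfolding XM by (simp add: matrix_mul_assoc)
  then have "is_mp_inverse M (W ** M ** Y)"
    unfolding is_mp_inverse_def MX XM using W Y by simp
  then show ?thesis ..
qed

text \<open>Both \<open>M ** X\<close> and \<open>M ** Y\<close> are the orthogonal projection onto
  the range of \<open>M\<close>, so they agree; likewise \<open>X ** M\<close> and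
  \<open>Y ** M\<close> project onto the range of \<open>transpose M\<close>.\<close>

lemma is_mp_inverse_unique:
  assumes X: "is_mp_inverse M X" and Y: "is_mp_inverse M Y"
  shows "X = Y"
proof -
  have "M ** X = transpose (M ** Y ** (M ** X))"
    using X Y by (simp add: is_mp_inverse_def matrix_mul_assoc)
  also have "\<dots> = M ** X ** (M ** Y)"
    using X Y by (simp add: is_mp_inverse_def matrix_transpose_mul[of "M ** Y"])
  also have "\<dots> = M ** Y"
    using X by (simp add: is_mp_inverse_def matrix_mul_assoc)
  finally have MX: "M ** X = M ** Y" .
  have "X ** M = transpose (X ** M ** (Y ** M))"
    using X Y by (simp add: is_mp_inverse_def matrix_mul_assoc[symmetric])
  also have "\<dots> = Y ** M ** (X ** M)"
    using X Y by (simp add: is_mp_inverse_def matrix_transpose_mul[of "X ** M"])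
  also have "\<dots> = Y ** M"
    using X by (simp add: is_mp_inverse_def matrix_mul_assoc[symmetric])
  finally have XM: "X ** M = Y ** M" .
  have "X = X ** M ** X"
    using X by (simp add: is_mp_inverse_def)
  also have "\<dots> = Y ** (M ** X)"
    by (simp add: XM matrix_mul_assoc)
  also have "\<dots> = Y"
    using Y by (simp add: MX is_mp_inverse_def matrix_mul_assoc)
  finally show ?thesis .
qed

lemma real_mp_inverse_eq_iff: "real_mp_inverse M = X \<longleftrightarrow> is_mp_inverse M X"
  unfolding real_mp_inverse_def
  using is_mp_inverse_exists is_mp_inverse_unique by (metis the_equality)

section \<open>The real representation\<close>

lemma sum_UNIV_Plus:
  fixes f :: "'a::finite + 'b::finite \<Rightarrow> 'c::comm_monoid_add"
  shows "sum f UNIV = (\<Sum>i\<in>UNIV. f (Inl i)) + (\<Sum>i\<in>UNIV. f (Inr i))"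
  by (subst UNIV_Plus_UNIV[symmetric], subst sum.Plus) simp_all

lemma sq_sum:
  "sq1 (sum f S) = (\<Sum>i\<in>S. sq1 (f i))" "sq2 (sum f S) = (\<Sum>i\<in>S. sq2 (f i))"
  "sq3 (sum f S) = (\<Sum>i\<in>S. sq3 (f i))" "sq4 (sum f S) = (\<Sum>i\<in>S. sq4 (f i))"
  by (induction S rule: infinite_finite_induct) simp_all

lemma real_rep_eq_iff: "real_rep A = real_rep B \<longleftrightarrow> A = B"
  by (rule inj_eq[OF bij_is_inj[OF bij_real_rep]])

text \<open>Blockwise, 1, i, j, k become the 2x2 matrices ((1,0),(0,1)), ((0,-1),(1,0)),
  ((1,0),(0,-1)), ((0,1),(1,0)), which have the multiplication table of the units.\<close>

lemma real_rep_mult: "real_rep (A ** B) = real_rep A ** real_rep B"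
  by (simp add: vec_eq_iff real_rep_def matrix_matrix_mult_def sum_UNIV_Plus sq_sum
      sum.distrib sum_subtractf sum_negf algebra_simps split: sum.split)

text \<open>Of the 2x2 matrices of the units, that of i is antisymmetric and the others are
  symmetric, which is why only \<open>sq2\<close> changes sign.\<close>

lemma real_rep_i_conj_transpose: "real_rep (A\<^sup>H) = transpose (real_rep A)"
  by (simp add: vec_eq_iff real_rep_def i_conj_transpose_def transpose_def split: sum.split)

section \<open>The Penrose equations over the split quaternions\<close>

lemma i_conj_transpose_i_conj_transpose: "(A\<^sup>H)\<^sup>H = A"
  by (simp add: vec_eq_iff i_conj_transpose_def squat_eq_iff)

lemma i_conj_transpose_mult: "(A ** B)\<^sup>H = B\<^sup>H ** A\<^sup>H"
  by (rule real_rep_eq_iff[THEN iffD1])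
    (simp add: real_rep_mult real_rep_i_conj_transpose matrix_transpose_mul)

lemma mp_inverse_eq_iff:
  "A\<^sup>\<dagger> = X \<longleftrightarrow> A ** X ** A = A \<and> X ** A ** X = X
     \<and> (A ** X)\<^sup>H = A ** X \<and> (X ** A)\<^sup>H = X ** A"
proof -
  have "A\<^sup>\<dagger> = X \<longleftrightarrow> real_mp_inverse (real_rep A) = real_rep X"
    unfolding mp_inverse_def using bij_real_rep by (metis bij_inv_eq_iff)
  also have "\<dots> \<longleftrightarrow> is_mp_inverse (real_rep A) (real_rep X)"
    by (rule real_mp_inverse_eq_iff)
  finally show ?thesis
    by (simp add: is_mp_inverse_def real_rep_eq_iff
        flip: real_rep_mult real_rep_i_conj_transpose)
qed

lemma mp_inverse_penrose:
  "A ** A\<^sup>\<dagger> ** A = A" "A\<^sup>\<dagger> ** A ** A\<^sup>\<dagger> = A\<^sup>\<dagger>"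
  "(A ** A\<^sup>\<dagger>)\<^sup>H = A ** A\<^sup>\<dagger>" "(A\<^sup>\<dagger> ** A)\<^sup>H = A\<^sup>\<dagger> ** A"
  using mp_inverse_eq_iff[of A "A\<^sup>\<dagger>"] by simp_all

text \<open>Swapping \<open>A\<close> and \<open>A\<^sup>\<dagger>\<close> only permutes the Penrose
  equations.\<close>

lemma mp_inverse_mp_inverse: "(A\<^sup>\<dagger>)\<^sup>\<dagger> = A"
  by (simp add: mp_inverse_eq_iff mp_inverse_penrose)

text \<open>Since \<open>\<^sup>H\<close> reverses products, it preserves the first two equations
  and swaps the two symmetry conditions.\<close>

lemma mp_inverse_i_conj_transpose: "(A\<^sup>H)\<^sup>\<dagger> = (A\<^sup>\<dagger>)\<^sup>H"
  unfolding mp_inverse_eq_iff i_conj_transpose_mult[symmetric]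
  by (simp add: mp_inverse_penrose matrix_mul_assoc)

lemma squat_matrix_scaleR_mult:
  fixes A :: "squat^'n^'m"
  shows "(r *\<^sub>R A) ** B = r *\<^sub>R (A ** B)" "A ** (r *\<^sub>R B) = r *\<^sub>R (A ** B)"
  by (simp_all add: vec_eq_iff matrix_matrix_mult_def scaleR_sum_right)

lemma mp_inverse_scaleR:
  assumes "r \<noteq> 0"
  shows "(r *\<^sub>R A)\<^sup>\<dagger> = inverse r *\<^sub>R A\<^sup>\<dagger>"
  using assms by (simp add: mp_inverse_eq_iff mp_inverse_penrose squat_matrix_scaleR_mult)

text \<open>The inner unitary factors cancel, so the two products are
  \<open>A ** A\<^sup>\<dagger>\<close> conjugated by \<open>U\<close> and
  \<open>A\<^sup>\<dagger> ** A\<close> conjugated by \<open>V\<^sup>H\<close>.\<close>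

lemma mp_inverse_unitary_mult:
  fixes A :: "squat^'n^'m"
  assumes U: "U\<^sup>H ** U = mat 1" and V: "V ** V\<^sup>H = mat 1"
  shows "(U ** A ** V)\<^sup>\<dagger> = V\<^sup>H ** A\<^sup>\<dagger> ** U\<^sup>H"
proof -
  have U': "U\<^sup>H ** (U ** B) = B" for B :: "squat^'c^'m"
    by (simp add: U matrix_mul_assoc)
  have V': "V ** (V\<^sup>H ** B) = B" for B :: "squat^'c^'n"
    by (simp add: V matrix_mul_assoc)
  have l: "U ** A ** V ** (V\<^sup>H ** A\<^sup>\<dagger> ** U\<^sup>H) = U ** (A ** A\<^sup>\<dagger>) ** U\<^sup>H"
    by (simp add: V' flip: matrix_mul_assoc)
  have r: "V\<^sup>H ** A\<^sup>\<dagger> ** U\<^sup>H ** (U ** A ** V) = V\<^sup>H ** (A\<^sup>\<dagger> ** A) ** V"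
    by (simp add: U' flip: matrix_mul_assoc)
  have "U ** (A ** A\<^sup>\<dagger>) ** U\<^sup>H ** (U ** A ** V) = U ** (A ** A\<^sup>\<dagger> ** A) ** V"
    by (simp add: U' flip: matrix_mul_assoc)
  moreover have "V\<^sup>H ** (A\<^sup>\<dagger> ** A) ** V ** (V\<^sup>H ** A\<^sup>\<dagger> ** U\<^sup>H) = V\<^sup>H ** (A\<^sup>\<dagger> ** A ** A\<^sup>\<dagger>) ** U\<^sup>H"
    by (simp add: V' flip: matrix_mul_assoc)
  moreover have "(U ** (A ** A\<^sup>\<dagger>) ** U\<^sup>H)\<^sup>H = U ** (A ** A\<^sup>\<dagger>) ** U\<^sup>H"
    \<comment> \<open>Only the outer factors are split off, which keeps
      \<open>A ** A\<^sup>\<dagger>\<close> intact for its own symmetry equation.\<close>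
    unfolding i_conj_transpose_mult[of _ "U\<^sup>H"] i_conj_transpose_mult[of U]
    by (simp add: mp_inverse_penrose i_conj_transpose_i_conj_transpose matrix_mul_assoc)
  moreover have "(V\<^sup>H ** (A\<^sup>\<dagger> ** A) ** V)\<^sup>H = V\<^sup>H ** (A\<^sup>\<dagger> ** A) ** V"
    unfolding i_conj_transpose_mult[of _ V] i_conj_transpose_mult[of "V\<^sup>H"]
    by (simp add: mp_inverse_penrose i_conj_transpose_i_conj_transpose matrix_mul_assoc)
  ultimately show ?thesis
    by (simp only: mp_inverse_eq_iff l r mp_inverse_penrose)
qed

theorem proposition3p5:
  fixes A :: "squat^'n^'m" and U :: "squat^'m^'m" and V :: "squat^'n^'n" and lam :: real
  assumes "lam \<noteq> 0"
    and "U\<^sup>H ** U = mat 1" and "U ** U\<^sup>H = mat 1"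
    and "V\<^sup>H ** V = mat 1" and "V ** V\<^sup>H = mat 1"
  shows "(A\<^sup>\<dagger>)\<^sup>\<dagger> = A
    \<and> (A\<^sup>H)\<^sup>\<dagger> = (A\<^sup>\<dagger>)\<^sup>H
    \<and> (lam *\<^sub>R A)\<^sup>\<dagger> = inverse lam *\<^sub>R A\<^sup>\<dagger>
    \<and> (U ** A ** V)\<^sup>\<dagger> = V\<^sup>H ** A\<^sup>\<dagger> ** U\<^sup>H
    \<and> (A ** A\<^sup>\<dagger>)\<^sup>H = A ** A\<^sup>\<dagger> \<and> (A ** A\<^sup>\<dagger>) ** (A ** A\<^sup>\<dagger>) = A ** A\<^sup>\<dagger>
    \<and> (A\<^sup>\<dagger> ** A)\<^sup>H = A\<^sup>\<dagger> ** A \<and> (A\<^sup>\<dagger> ** A) ** (A\<^sup>\<dagger> ** A) = A\<^sup>\<dagger> ** A"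
  \<comment> \<open>Both idempotence claims are one of the first two Penrose equations multiplied on
    the right by \<open>A\<^sup>\<dagger>\<close> or \<open>A\<close>.\<close>
  using assms
  by (simp add: mp_inverse_mp_inverse mp_inverse_i_conj_transpose mp_inverse_scaleR
      mp_inverse_unitary_mult mp_inverse_penrose matrix_mul_assoc)

end
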